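(* The variety $\mathbb{PP}$ of all perfect paradefinite algebras is generated by the single six-element algebra $\mathbf{PP}_6$; that is, $\mathbb{PP}=\mathbb{V}(\{\mathbf{PP}_6\})$.
   Context: A De Morgan algebra is a bounded distributive lattice $\langle A;\land,\lor,\top,\bot\rangle$ with a unary operation $\sim$ satisfying ${\sim}{\sim}x\approx x$ and ${\sim}(x\land y)\approx{\sim}x\lor{\sim}y$. A perfect paradefinite algebra (PP-algebra) is a De Morgan algebra with an additional unary operation $\circ$ satisfying: (PP1) $\circ\circ x\approx\top$; (PP2) $\circ x\approx\circ{\sim}x$; (PP3) $\circ\top\approx\top$; (PP4) $x\land{\sim}x\land\circ x\approx\bot$; (PP5) $\circ(x\land y)\approx(\circ x\lor\circ y)\land(\circ x\lor{\sim}y)\land(\circ y\lor{\sim}x)$. $\mathbf{PP}_6$ is the PP-algebra with six distinct elements $\hat{\mathbf f},\mathbf f,\mathbf n,\mathbf b,\mathbf t,\hat{\mathbf t}$, whose lattice order is given by $\hat{\mathbf f}<\mathbf f<\mathbf n<\mathbf t<\hat{\mathbf t}$ and $\mathbf f<\mathbf b<\mathbf t$ with $\mathbf n,\mathbf b$ incomparable, $\top=\hat{\mathbf t}$, $\bot=\hat{\mathbf f}$; ${\sim}$ swaps $\mathbf f$ and $\mathbf t$, swaps $\hat{\mathbf f}$ and $\hat{\mathbf t}$, and fixes $\mathbf n$ and $\mathbf b$; and $\circ a=\hat{\mathbf t}$ if $a\in\{\hat{\mathbf f},\hat{\mathbf t}\}$, $\circ a=\hat{\mathbf f}$ otherwise.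 $\mathbb{V}(\mathsf K)$ is the variety generated by $\mathsf K$ (closure under homomorphic images, subalgebras and direct products). *)

theory Defs
  imports Main "HOL-Library.FuncSet"
begin

section \<open>Algebras over an explicit universe\<close>

text \<open>The values of the operations outside the universe are irrelevant: all notions below
  only look at the operations on the universe.\<close>

record 'a bl_alg =
  univ :: "'a set"
  meet :: "'a \<Rightarrow> 'a \<Rightarrow> 'a"
  join :: "'a \<Rightarrow> 'a \<Rightarrow> 'a"
  tp :: 'a
  bt :: 'a

record 'a dm_alg = "'a bl_alg" +
  neg :: "'a \<Rightarrow> 'a"

record 'a pp_alg = "'a dm_alg" +
  circ :: "'a \<Rightarrow> 'a"

locale bounded_distributive_lattice =
  fixes A :: "('a, 'm) bl_alg_scheme"
  assumes meet_closed: "\<lbrakk>x \<in> univ A; y \<in> univ A\<rbrakk> \<Longrightarrow> meet A x y \<in> univ A"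
    and join_closed: "\<lbrakk>x \<in> univ A; y \<in> univ A\<rbrakk> \<Longrightarrow> join A x y \<in> univ A"
    and tp_closed: "tp A \<in> univ A"
    and bt_closed: "bt A \<in> univ A"
    and meet_assoc: "\<lbrakk>x \<in> univ A; y \<in> univ A; z \<in> univ A\<rbrakk>
          \<Longrightarrow> meet A (meet A x y) z = meet A x (meet A y z)"
    and join_assoc: "\<lbrakk>x \<in> univ A; y \<in> univ A; z \<in> univ A\<rbrakk>
          \<Longrightarrow> join A (join A x y) z = join A x (join A y z)"
    and meet_commute: "\<lbrakk>x \<in> univ A; y \<in> univ A\<rbrakk> \<Longrightarrow> meet A x y = meet A y x"
    and join_commute: "\<lbrakk>x \<in> univ A; y \<in> univ A\<rbrakk> \<Longrightarrow> join A x y = join A y x"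
    and meet_absorb: "\<lbrakk>x \<in> univ A; y \<in> univ A\<rbrakk> \<Longrightarrow> meet A x (join A x y) = x"
    and join_absorb: "\<lbrakk>x \<in> univ A; y \<in> univ A\<rbrakk> \<Longrightarrow> join A x (meet A x y) = x"
    and meet_join_distrib: "\<lbrakk>x \<in> univ A; y \<in> univ A; z \<in> univ A\<rbrakk>
          \<Longrightarrow> meet A x (join A y z) = join A (meet A x y) (meet A x z)"
    and meet_tp: "x \<in> univ A \<Longrightarrow> meet A x (tp A) = x"
    and join_bt: "x \<in> univ A \<Longrightarrow> join A x (bt A) = x"

locale de_morgan_algebra = bounded_distributive_lattice A
  for A :: "('a, 'm) dm_alg_scheme" +
  assumes neg_closed: "x \<in> univ A \<Longrightarrow> neg A x \<in> univ A"
    and neg_neg: "x \<in> univ A \<Longrightarrow> neg A (neg A x) = x"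
    and neg_meet: "\<lbrakk>x \<in> univ A; y \<in> univ A\<rbrakk>
          \<Longrightarrow> neg A (meet A x y) = join A (neg A x) (neg A y)"

locale pp_algebra = de_morgan_algebra A
  for A :: "'a pp_alg" +
  assumes circ_closed: "x \<in> univ A \<Longrightarrow> circ A x \<in> univ A"
    and PP1: "x \<in> univ A \<Longrightarrow> circ A (circ A x) = tp A"
    and PP2: "x \<in> univ A \<Longrightarrow> circ A x = circ A (neg A x)"
    and PP3: "circ A (tp A) = tp A"
    and PP4: "x \<in> univ A \<Longrightarrow> meet A (meet A x (neg A x)) (circ A x) = bt A"
    and PP5: "\<lbrakk>x \<in> univ A; y \<in> univ A\<rbrakk> \<Longrightarrow>
          circ A (meet A x y) =
            meet A (meet A (join A (circ A x) (circ A y)) (join A (circ A x) (neg A y)))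
              (join A (circ A y) (neg A x))"

section \<open>Homomorphic images, subalgebras, direct products\<close>

definition hom :: "'a pp_alg \<Rightarrow> 'b pp_alg \<Rightarrow> ('a \<Rightarrow> 'b) set" where
  "hom A B = {h. h ` univ A \<subseteq> univ B
     \<and> (\<forall>x\<in>univ A. \<forall>y\<in>univ A. h (meet A x y) = meet B (h x) (h y))
     \<and> (\<forall>x\<in>univ A. \<forall>y\<in>univ A. h (join A x y) = join B (h x) (h y))
     \<and> h (tp A) = tp B \<and> h (bt A) = bt B
     \<and> (\<forall>x\<in>univ A. h (neg A x) = neg B (h x))
     \<and> (\<forall>x\<in>univ A. h (circ A x) = circ B (h x))}"

definition hom_image :: "'a pp_alg \<Rightarrow> 'b pp_alg \<Rightarrow> bool" where
  "hom_image A B \<longleftrightarrow> (\<exists>h\<in>hom A B. h ` univ A = univ B)"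

definition isomorphic :: "'a pp_alg \<Rightarrow> 'b pp_alg \<Rightarrow> bool" where
  "isomorphic A B \<longleftrightarrow> (\<exists>h\<in>hom A B. bij_betw h (univ A) (univ B))"

definition subuniverse :: "'a set \<Rightarrow> 'a pp_alg \<Rightarrow> bool" where
  "subuniverse S A \<longleftrightarrow> S \<subseteq> univ A \<and> tp A \<in> S \<and> bt A \<in> S
     \<and> (\<forall>x\<in>S. \<forall>y\<in>S. meet A x y \<in> S \<and> join A x y \<in> S)
     \<and> (\<forall>x\<in>S. neg A x \<in> S \<and> circ A x \<in> S)"

definition direct_product :: "'i set \<Rightarrow> ('i \<Rightarrow> 'a pp_alg) \<Rightarrow> ('i \<Rightarrow> 'a) pp_alg" where
  "direct_product I F =
     \<lparr> univ = (\<Pi>\<^sub>E i\<in>I. univ (F i)),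
       meet = (\<lambda>f g. \<lambda>i\<in>I. meet (F i) (f i) (g i)),
       join = (\<lambda>f g. \<lambda>i\<in>I. join (F i) (f i) (g i)),
       tp = (\<lambda>i\<in>I. tp (F i)),
       bt = (\<lambda>i\<in>I. bt (F i)),
       neg = (\<lambda>f. \<lambda>i\<in>I. neg (F i) (f i)),
       circ = (\<lambda>f. \<lambda>i\<in>I. circ (F i) (f i)) \<rparr>"

section \<open>The variety generated by a class of algebras\<close>

text \<open>The closure of \<open>K\<close> under homomorphic images, subalgebras and direct products, among the
  algebras whose elements are taken from a type \<open>'u\<close>. The generators and the direct products
  live in other types, so they enter as isomorphic copies. Indexing the products by subsets of
  \<open>'u\<close> loses no product that has a copy in \<open>'u\<close>: factors with one element can be dropped, and
  a product of \<open>\<kappa>\<close> factors with at least two elements has at least \<open>2\<^sup>\<kappa>\<close> elements.\<close>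

inductive_set variety_in :: "'b pp_alg set \<Rightarrow> 'u pp_alg set"
  for K :: "'b pp_alg set" where
  generator: "\<lbrakk>A \<in> K; isomorphic A B\<rbrakk> \<Longrightarrow> B \<in> variety_in K"
| image: "\<lbrakk>A \<in> variety_in K; hom_image A B\<rbrakk> \<Longrightarrow> B \<in> variety_in K"
| subalgebra: "\<lbrakk>A \<in> variety_in K; subuniverse S A\<rbrakk> \<Longrightarrow> A\<lparr>univ := S\<rparr> \<in> variety_in K"
| product: "\<lbrakk>\<And>i. i \<in> I \<Longrightarrow> F i \<in> variety_in K; isomorphic (direct_product (I :: 'u set) F) B\<rbrakk>
    \<Longrightarrow> B \<in> variety_in K"

text \<open>An algebra \<open>A\<close> belongs to the variety generated by \<open>K\<close> iff \<open>in_variety TYPE('u) K A\<close> holds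
  for some type \<open>'u\<close>. (A fixed \<open>'u\<close> may be too small to hold the products that are needed
  for \<open>A\<close>.) A quantifier over types is not available inside a formula, so the claim that
  membership implies \<open>P A\<close> is stated for a type variable \<open>'u\<close>, and the claim that \<open>P A\<close> implies
  membership is stated for a concrete witness type.\<close>

definition in_variety :: "'u itself \<Rightarrow> 'b pp_alg set \<Rightarrow> 'a pp_alg \<Rightarrow> bool" where
  "in_variety U K A \<longleftrightarrow> (\<exists>B \<in> (variety_in K :: 'u pp_alg set). isomorphic B A)"

section \<open>The six-element algebra\<close>

text \<open>\<open>V_fh\<close> and \<open>V_th\<close> are the hatted values.\<close>

datatype six = V_fh | V_f | V_n | V_b | V_t | V_th

instantiation six :: "{distrib_lattice, bounded_lattice}"
begin

definition less_eq_six :: "six \<Rightarrow> six \<Rightarrow> bool" where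
  "x \<le> y \<longleftrightarrow> x = y \<or> x = V_fh \<or> y = V_th \<or> (x = V_f \<and> y \<noteq> V_fh) \<or> (y = V_t \<and> x \<noteq> V_th)"

definition less_six :: "six \<Rightarrow> six \<Rightarrow> bool" where
  "x < y \<longleftrightarrow> x \<le> y \<and> x \<noteq> (y :: six)"

text \<open>The only incomparable elements are \<open>V_n\<close> and \<open>V_b\<close>.\<close>

definition inf_six :: "six \<Rightarrow> six \<Rightarrow> six" where
  "inf x y = (if x \<le> y then x else if y \<le> x then y else V_f)"

definition sup_six :: "six \<Rightarrow> six \<Rightarrow> six" where
  "sup x y = (if x \<le> y then y else if y \<le> x then x else V_t)"

definition bot_six :: six where "bot = V_fh"

definition top_six :: six where "top = V_th"

instance
proof
  fix x y z :: six
  show "(x < y) = (x \<le> y \<and> \<not> y \<le> x)"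
    by (cases x; cases y) (simp_all add: less_six_def less_eq_six_def)
  show "x \<le> x"
    by (simp add: less_eq_six_def)
  show "x \<le> y \<Longrightarrow> y \<le> z \<Longrightarrow> x \<le> z"
    by (cases x; cases y; cases z) (simp_all add: less_eq_six_def)
  show "x \<le> y \<Longrightarrow> y \<le> x \<Longrightarrow> x = y"
    by (cases x; cases y) (simp_all add: less_eq_six_def)
  show "inf x y \<le> x" "inf x y \<le> y"
    by (cases x; cases y; simp add: inf_six_def less_eq_six_def)+
  show "x \<le> y \<Longrightarrow> x \<le> z \<Longrightarrow> x \<le> inf y z"
    by (cases x; cases y; cases z) (simp_all add: inf_six_def less_eq_six_def)
  show "x \<le> sup x y" "y \<le> sup x y"
    by (cases x; cases y; simp add: sup_six_def less_eq_six_def)+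
  show "y \<le> x \<Longrightarrow> z \<le> x \<Longrightarrow> sup y z \<le> x"
    by (cases x; cases y; cases z) (simp_all add: sup_six_def less_eq_six_def)
  show "bot \<le> x"
    by (simp add: bot_six_def less_eq_six_def)
  show "x \<le> top"
    by (simp add: top_six_def less_eq_six_def)
  show "sup x (inf y z) = inf (sup x y) (sup x z)"
    by (cases x; cases y; cases z) (simp_all add: inf_six_def sup_six_def less_eq_six_def)
qed

end

fun six_neg :: "six \<Rightarrow> six" where
  "six_neg V_fh = V_th"
| "six_neg V_f = V_t"
| "six_neg V_n = V_n"
| "six_neg V_b = V_b"
| "six_neg V_t = V_f"
| "six_neg V_th = V_fh"

definition six_circ :: "six \<Rightarrow> six" where
  "six_circ a = (if a \<in> {V_fh, V_th} then V_th else V_fh)"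

definition PP6 :: "six pp_alg" where
  "PP6 = \<lparr> univ = UNIV, meet = inf, join = sup, tp = top, bt = bot,
           neg = six_neg, circ = six_circ \<rparr>"

end

theory Submission
  imports Defs
begin

text \<open>The algebra \<open>PP6\<close> satisfies the axioms of PP-algebras, and these axioms are identities, so they
  are inherited by isomorphic copies, homomorphic images, subalgebras and direct products. Hence
  every member of the variety generated by \<open>PP6\<close> is a PP-algebra.

  Conversely, every PP-algebra \<open>A\<close> embeds into a power of \<open>PP6\<close>, because the homomorphisms from
  \<open>A\<close> to \<open>PP6\<close> separate its points (\<open>homs_separate_points\<close>). If \<open>a\<close> is not below \<open>b\<close>, the prime
  filter theorem gives a prime filter \<open>P\<close> of the lattice \<open>A\<close> with \<open>a \<in> P\<close> and \<open>b \<notin> P\<close>. In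
  \<open>PP6\<close> the set \<open>D = {V_b, V_t, V_th}\<close> is a prime filter, and a value \<open>v\<close> is determined by the
  three tests whether \<open>v\<close>, the negation of \<open>v\<close> and the circle of \<open>v\<close> lie in \<open>D\<close>. Sending \<open>x\<close> to
  the value that answers these tests as \<open>x\<close> answers them for \<open>P\<close> is a homomorphism
  (\<open>prime_filter_hom_in_hom\<close>): PP4 makes the answers consistent with a value, and PP5 is what
  computes the third test of a meet. As \<open>P\<close> contains \<open>a\<close> but not \<open>b\<close>, the homomorphism sends \<open>a\<close>
  into \<open>D\<close> and \<open>b\<close> outside of it.

  It remains to find the power among the algebras that \<open>variety_in\<close> ranges over. The exponent is
  the set \<open>hom A PP6\<close>, whose elements have type \<open>'a \<Rightarrow> six\<close>, so the power has
  elements of type \<open>('a \<Rightarrow> six) \<Rightarrow> six\<close>, the type in the theorem.\<close>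

section \<open>Perfect paradefinite algebras form a variety\<close>

lemmas pp_algebra_axioms_unfold =
  pp_algebra_def pp_algebra_axioms_def de_morgan_algebra_def de_morgan_algebra_axioms_def
  bounded_distributive_lattice_def

lemma isomorphic_imp_hom_image: "isomorphic A B \<Longrightarrow> hom_image A B"
  by (auto simp: isomorphic_def hom_image_def bij_betw_def)

lemma hom_ops:
  assumes "h \<in> hom A B"
  shows "\<lbrakk>x \<in> univ A; y \<in> univ A\<rbrakk> \<Longrightarrow> meet B (h x) (h y) = h (meet A x y)"
    and "\<lbrakk>x \<in> univ A; y \<in> univ A\<rbrakk> \<Longrightarrow> join B (h x) (h y) = h (join A x y)"
    and "tp B = h (tp A)"
    and "bt B = h (bt A)"
    and "x \<in> univ A \<Longrightarrow> neg B (h x) = h (neg A x)"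
    and "x \<in> univ A \<Longrightarrow> circ B (h x) = h (circ A x)"
  using assms by (auto simp: hom_def)

text \<open>Every element of \<open>B\<close> is of the form \<open>h x\<close>, and \<open>hom_ops\<close> pulls the operations of \<open>B\<close> under
  \<open>h\<close>, so that each axiom for \<open>B\<close> becomes \<open>h\<close> applied to both sides of the same axiom for \<open>A\<close>.\<close>

lemma pp_algebra_hom_image:
  assumes "pp_algebra A" and "hom_image A B"
  shows "pp_algebra B"
proof -
  interpret pp_algebra A by fact
  obtain h where h: "h \<in> hom A B" and img: "univ B = h ` univ A"
    using assms(2) by (auto simp: hom_image_def)
  note ops = hom_ops[OF h]
  note closed = meet_closed join_closed tp_closed bt_closed neg_closed circ_closed
  show ?thesis
    unfolding pp_algebra_axioms_unfold img
    by (safe; simp add: ops closed; rule arg_cong[where f = h] imageI;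
        (rule meet_assoc join_assoc meet_commute join_commute meet_absorb join_absorb
          meet_join_distrib meet_tp join_bt neg_neg neg_meet PP1 PP2 PP3 PP4 PP5
          meet_closed join_closed tp_closed bt_closed neg_closed circ_closed; assumption))
qed

lemma pp_algebra_subalgebra:
  assumes "pp_algebra A" and "subuniverse S A"
  shows "pp_algebra (A\<lparr>univ := S\<rparr>)"
proof -
  interpret pp_algebra A by fact
  have S: "\<And>x. x \<in> S \<Longrightarrow> x \<in> univ A" "tp A \<in> S" "bt A \<in> S"
    "\<And>x y. x \<in> S \<Longrightarrow> y \<in> S \<Longrightarrow> meet A x y \<in> S" "\<And>x y. x \<in> S \<Longrightarrow> y \<in> S \<Longrightarrow> join A x y \<in> S"
    "\<And>x. x \<in> S \<Longrightarrow> neg A x \<in> S" "\<And>x. x \<in> S \<Longrightarrow> circ A x \<in> S"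
    using assms(2) by (auto simp: subuniverse_def)
  show ?thesis
    unfolding pp_algebra_axioms_unfold
    by (intro conjI allI impI; simp add: S;
        (rule meet_assoc join_assoc meet_commute join_commute meet_absorb join_absorb
          meet_join_distrib meet_tp join_bt neg_neg neg_meet PP1 PP2 PP3 PP4 PP5;
         simp add: S)?)
qed

lemma pp_algebra_direct_product:
  fixes F :: "'i \<Rightarrow> 'b pp_alg"
  assumes "\<And>i. i \<in> I \<Longrightarrow> pp_algebra (F i)"
  shows "pp_algebra (direct_product I F)"
proof -
  have dm: "de_morgan_algebra (F i)" if "i \<in> I" for i
    using assms[OF that] by (simp add: pp_algebra_def)
  then have bdl: "bounded_distributive_lattice (F i)" if "i \<in> I" for i
    using that by (simp add: de_morgan_algebra_def)
  note closed = bounded_distributive_lattice.meet_closed[OF bdl]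
    bounded_distributive_lattice.join_closed[OF bdl]
    bounded_distributive_lattice.tp_closed[OF bdl]
    bounded_distributive_lattice.bt_closed[OF bdl]
    de_morgan_algebra.neg_closed[OF dm] pp_algebra.circ_closed[OF assms]
  note eqs = bounded_distributive_lattice.meet_assoc[OF bdl]
    bounded_distributive_lattice.join_assoc[OF bdl]
    bounded_distributive_lattice.meet_commute[OF bdl]
    bounded_distributive_lattice.join_commute[OF bdl]
    bounded_distributive_lattice.meet_absorb[OF bdl]
    bounded_distributive_lattice.join_absorb[OF bdl]
    bounded_distributive_lattice.meet_join_distrib[OF bdl]
    bounded_distributive_lattice.meet_tp[OF bdl]
    bounded_distributive_lattice.join_bt[OF bdl]
    de_morgan_algebra.neg_neg[OF dm] de_morgan_algebra.neg_meet[OF dm]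
    pp_algebra.PP1[OF assms] pp_algebra.PP2[OF assms] pp_algebra.PP3[OF assms]
    pp_algebra.PP4[OF assms] pp_algebra.PP5[OF assms]
  \<comment> \<open>An identity in the product is checked in each coordinate; outside \<open>I\<close> both sides are
    \<open>undefined\<close>.\<close>
  have ext: "(\<lambda>i\<in>I. t i) = g" if "\<And>i. i \<in> I \<Longrightarrow> t i = g i" "g \<in> extensional I"
    for t g :: "'i \<Rightarrow> 'b"
    using that by (auto simp: fun_eq_iff extensional_def)
  show ?thesis
    unfolding pp_algebra_axioms_unfold direct_product_def
    by (intro conjI allI impI; simp add: closed PiE_iff;
        (rule ext; simp add: PiE_iff; (rule eqs; simp add: closed PiE_iff))?)
qed

lemma pp_algebra_PP6: "pp_algebra PP6"
proof -
  have neg_neg: "six_neg (six_neg x) = x" for x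
    by (cases x) auto
  have neg_meet: "six_neg (inf x y) = sup (six_neg x) (six_neg y)" for x y
    by (cases x; cases y) (auto simp: inf_six_def sup_six_def less_eq_six_def)
  have circ: "six_circ (six_circ x) = top" "six_circ x = six_circ (six_neg x)"
    "inf (inf x (six_neg x)) (six_circ x) = bot" for x
    by (cases x; simp add: six_circ_def inf_six_def less_eq_six_def top_six_def bot_six_def)+
  have circ_top: "six_circ top = top"
    by (simp add: six_circ_def top_six_def)
  have circ_meet: "six_circ (inf x y) =
      inf (inf (sup (six_circ x) (six_circ y)) (sup (six_circ x) (six_neg y)))
        (sup (six_circ y) (six_neg x))" for x y
    by (cases x; cases y) (auto simp: six_circ_def inf_six_def sup_six_def less_eq_six_def)
  show ?thesis
    unfolding pp_algebra_axioms_unfold PP6_def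
    by (intro conjI allI impI; simp;
        (rule inf.assoc sup.assoc inf.commute sup.commute inf_sup_distrib1
          neg_neg neg_meet circ circ_top circ_meet)?)
qed

lemma pp_algebra_variety_in:
  assumes "\<And>A. A \<in> K \<Longrightarrow> pp_algebra A" and "B \<in> variety_in K"
  shows "pp_algebra B"
  using assms(2)
proof (induction rule: variety_in.induct)
  case (generator A B)
  then show ?case
    using assms(1) isomorphic_imp_hom_image pp_algebra_hom_image by metis
next
  case (image A B)
  then show ?case
    using pp_algebra_hom_image by metis
next
  case (subalgebra A S)
  then show ?case
    using pp_algebra_subalgebra by metis
next
  case (product I F B)
  then show ?case
    using pp_algebra_direct_product isomorphic_imp_hom_image pp_algebra_hom_image by metis
qed


section \<open>Prime filters\<close>

context bounded_distributive_lattice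
begin

text \<open>Upward closure is expressed with joins, as \<open>join A x y\<close> runs through the elements above \<open>x\<close>.
  The empty set counts as a filter.\<close>

definition lattice_filter :: "'a set \<Rightarrow> bool" where
  "lattice_filter F \<longleftrightarrow> F \<subseteq> univ A
     \<and> (\<forall>x\<in>F. \<forall>y\<in>F. meet A x y \<in> F)
     \<and> (\<forall>x\<in>F. \<forall>y\<in>univ A. join A x y \<in> F)"

definition prime_filter :: "'a set \<Rightarrow> bool" where
  "prime_filter P \<longleftrightarrow> lattice_filter P \<and> tp A \<in> P \<and> bt A \<notin> P
     \<and> (\<forall>x\<in>univ A. \<forall>y\<in>univ A. join A x y \<in> P \<longrightarrow> x \<in> P \<or> y \<in> P)"

lemma join_bt_left: "x \<in> univ A \<Longrightarrow> join A (bt A) x = x"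
  using join_bt join_commute bt_closed by metis

lemma meet_idem: "x \<in> univ A \<Longrightarrow> meet A x x = x"
  by (metis join_absorb meet_absorb meet_closed)

lemma join_tp: "x \<in> univ A \<Longrightarrow> join A x (tp A) = tp A"
  by (metis meet_tp join_commute join_absorb meet_commute tp_closed)

lemma join_meet_upper:
  assumes "x \<in> univ A" "y \<in> univ A" "z \<in> univ A"
    and "join A z x = z"
  shows "join A z (meet A x y) = z"
  by (metis assms join_absorb join_assoc meet_closed)

text \<open>\<open>G\<close> is the filter generated by \<open>F\<close> and \<open>x\<close>: its elements are those above some \<open>meet A f x\<close>.
  If \<open>z\<close> is above \<open>meet A f x\<close> and \<open>w\<close> is above \<open>meet A g x\<close>, then both are above the
  meet of \<open>meet A f g\<close> and \<open>x\<close>, and so is \<open>meet A z w\<close>.\<close>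

lemma lattice_filter_adjoin:
  assumes F: "lattice_filter F" and x: "x \<in> univ A" and "F \<noteq> {}"
  defines "G \<equiv> {z \<in> univ A. \<exists>f\<in>F. join A z (meet A f x) = z}"
  shows "lattice_filter G" and "F \<subseteq> G" and "x \<in> G"
proof -
  have FA: "F \<subseteq> univ A" and Fm: "\<And>f g. f \<in> F \<Longrightarrow> g \<in> F \<Longrightarrow> meet A f g \<in> F"
    using F by (auto simp: lattice_filter_def)
  show "F \<subseteq> G"
  proof
    fix f assume "f \<in> F"
    then show "f \<in> G"
      unfolding G_def using FA x by (auto intro!: bexI[of _ f] simp: join_absorb)
  qed
  show "x \<in> G"
    unfolding G_def using FA x \<open>F \<noteq> {}\<close>
    by simp (metis ex_in_conv join_absorb meet_commute subsetD)
  show "lattice_filter G"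
    unfolding lattice_filter_def
  proof (intro conjI ballI)
    show "G \<subseteq> univ A" by (auto simp: G_def)
  next
    fix z y assume "z \<in> G" and y: "y \<in> univ A"
    then obtain f where z: "z \<in> univ A" and f: "f \<in> F" "join A z (meet A f x) = z"
      by (auto simp: G_def)
    have "join A (join A z y) (meet A f x) = join A z y"
      by (smt (verit) FA f in_mono join_assoc join_commute meet_closed x y z)
    then show "join A z y \<in> G"
      using f y z by (auto simp: G_def join_closed)
  next
    fix z w assume "z \<in> G" "w \<in> G"
    then obtain f g where zw: "z \<in> univ A" "w \<in> univ A" and f: "f \<in> F" "join A z (meet A f x) = z"
      and g: "g \<in> F" "join A w (meet A g x) = w"
      by (auto simp: G_def)
    have fg: "f \<in> univ A" "g \<in> univ A" using f g FA by auto
    let ?p = "meet A f x" and ?q = "meet A g x"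
    let ?k = "meet A (meet A f g) x"
    have k: "?k \<in> univ A" "?p \<in> univ A" "?q \<in> univ A"
      using fg x by (auto intro: meet_closed)
    have "?k = meet A ?p g" "?k = meet A ?q f"
      by (metis fg x meet_assoc meet_commute meet_closed)+
    then have "join A z ?k = z" "join A w ?k = w"
      using join_meet_upper[of ?p g z] join_meet_upper[of ?q f w] k fg zw f g by metis+
    then have "meet A ?k z = ?k" "meet A ?k w = ?k"
      by (metis k zw join_commute meet_absorb)+
    then have "meet A ?k (meet A z w) = ?k"
      using k zw by (metis meet_assoc)
    then have "join A (meet A z w) ?k = meet A z w"
      by (metis k zw join_absorb meet_commute meet_closed)
    then show "meet A z w \<in> G"
      using f g zw Fm by (auto simp: G_def meet_closed)
  qed
qed

text \<open>By Zorn's lemma there is a filter \<open>P\<close> that is maximal among those containing \<open>a\<close> but not \<open>b\<close>.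
  If neither \<open>x\<close> nor \<open>y\<close> is in \<open>P\<close>, then by maximality adjoining either of them brings \<open>b\<close>
  into the filter; so \<open>b\<close> is above \<open>meet A k x\<close> and \<open>meet A k y\<close> for a common \<open>k \<in> P\<close>. By
  distributivity \<open>b\<close> is above \<open>meet A k (join A x y)\<close>, hence \<open>join A x y\<close> is not in \<open>P\<close>.\<close>

lemma prime_filter_separation:
  assumes a: "a \<in> univ A" and b: "b \<in> univ A" and "meet A a b \<noteq> a"
  obtains P where "prime_filter P" "a \<in> P" "b \<notin> P"
proof -
  let ?\<F> = "{F. lattice_filter F \<and> a \<in> F \<and> b \<notin> F}"
  \<comment> \<open>The principal filter of \<open>a\<close>, as the result of adjoining \<open>a\<close> to the least filter.\<close>
  let ?G = "{z \<in> univ A. \<exists>f\<in>{tp A}. join A z (meet A f a) = z}"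
  have top_filter: "lattice_filter {tp A}"
    by (auto simp: lattice_filter_def tp_closed meet_idem join_commute join_tp)
  have "b \<notin> ?G"
  proof
    assume "b \<in> ?G"
    then have "join A a b = b"
      using a b by (simp add: meet_commute[of "tp A"] tp_closed meet_tp join_commute)
    then show False
      using meet_absorb[OF a b] assms(3) by simp
  qed
  then have "?G \<in> ?\<F>"
    using lattice_filter_adjoin[OF top_filter a] by auto
  moreover have "\<Union>\<C> \<in> ?\<F>" if "\<C> \<noteq> {}" and "subset.chain ?\<F> \<C>" for \<C>
  proof -
    have C: "\<C> \<subseteq> ?\<F>" and ch: "\<And>X Y. X \<in> \<C> \<Longrightarrow> Y \<in> \<C> \<Longrightarrow> X \<subseteq> Y \<or> Y \<subseteq> X"
      using that by (auto simp: subset_chain_def)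
    have "meet A x y \<in> \<Union>\<C>" if xy: "x \<in> \<Union>\<C>" "y \<in> \<Union>\<C>" for x y
    proof -
      obtain X Y where XY: "X \<in> \<C>" "Y \<in> \<C>" "x \<in> X" "y \<in> Y" using xy by blast
      then obtain Z where "Z \<in> \<C>" "x \<in> Z" "y \<in> Z"
        using ch[OF XY(1,2)] by blast
      moreover have "lattice_filter Z" using C \<open>Z \<in> \<C>\<close> by blast
      ultimately show ?thesis unfolding lattice_filter_def by blast
    qed
    moreover have "\<Union>\<C> \<subseteq> univ A" "\<And>x y. x \<in> \<Union>\<C> \<Longrightarrow> y \<in> univ A \<Longrightarrow> join A x y \<in> \<Union>\<C>"
      using C unfolding lattice_filter_def by blast+
    moreover have "a \<in> \<Union>\<C>" "b \<notin> \<Union>\<C>"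
      using C \<open>\<C> \<noteq> {}\<close> by blast+
    ultimately show ?thesis
      by (auto simp: lattice_filter_def)
  qed
  ultimately obtain P where "P \<in> ?\<F>" and max: "\<forall>X\<in>?\<F>. P \<subseteq> X \<longrightarrow> X = P"
    using subset_Zorn_nonempty[of ?\<F>] by blast
  then have P: "lattice_filter P" "a \<in> P" "b \<notin> P" by auto
  have PA: "P \<subseteq> univ A" and Pm: "\<And>f g. f \<in> P \<Longrightarrow> g \<in> P \<Longrightarrow> meet A f g \<in> P"
    and Pj: "\<And>f g. f \<in> P \<Longrightarrow> g \<in> univ A \<Longrightarrow> join A f g \<in> P"
    using P(1) by (auto simp: lattice_filter_def)
  have below_b: "\<exists>f\<in>P. join A b (meet A f x) = b" if x: "x \<in> univ A" "x \<notin> P" for x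
  proof (rule ccontr)
    let ?X = "{z \<in> univ A. \<exists>f\<in>P. join A z (meet A f x) = z}"
    assume "\<not> ?thesis"
    then have "b \<notin> ?X" by blast
    moreover have "lattice_filter ?X" "P \<subseteq> ?X" "x \<in> ?X"
      using lattice_filter_adjoin[OF P(1) x(1)] P(2) by blast+
    ultimately show False
      using max P(2) x(2) by blast
  qed
  have prime: "x \<in> P \<or> y \<in> P" if xy: "x \<in> univ A" "y \<in> univ A" "join A x y \<in> P" for x y
  proof (rule ccontr)
    assume "\<not> ?thesis"
    then obtain f g where f: "f \<in> P" "join A b (meet A f x) = b"
      and g: "g \<in> P" "join A b (meet A g y) = b"
      using below_b xy by blast
    have fg: "f \<in> univ A" "g \<in> univ A" using f g PA by auto
    let ?k = "meet A f g"
    have k: "?k \<in> P" "?k \<in> univ A" using f g Pm PA by auto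
    have "meet A ?k x = meet A (meet A f x) g" "meet A ?k y = meet A (meet A g y) f"
      by (metis fg xy meet_assoc meet_commute meet_closed)+
    then have kb: "join A b (meet A ?k x) = b" "join A b (meet A ?k y) = b"
      using join_meet_upper[of "meet A f x" g b] join_meet_upper[of "meet A g y" f b] b fg xy f g
      by (simp_all add: meet_closed)
    have "join A (meet A ?k (join A x y)) b = b"
      using kb by (metis b k xy join_assoc join_commute meet_closed meet_join_distrib)
    moreover have "meet A ?k (join A x y) \<in> P" using Pm k xy by blast
    ultimately show False using Pj b P(3) by metis
  qed
  have "tp A \<in> P" using Pj[OF P(2) tp_closed] join_tp a by simp
  moreover have "bt A \<notin> P" using Pj[of "bt A" b] b P(3) join_bt_left by auto
  ultimately have "prime_filter P"
    using P(1) prime by (auto simp: prime_filter_def)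
  with P that show ?thesis by blast
qed

lemma prime_filter_meet:
  assumes "prime_filter P" "x \<in> univ A" "y \<in> univ A"
  shows "meet A x y \<in> P \<longleftrightarrow> x \<in> P \<and> y \<in> P"
  using assms unfolding prime_filter_def lattice_filter_def
  by (metis join_absorb join_commute meet_closed meet_commute)

lemma prime_filter_join:
  assumes "prime_filter P" "x \<in> univ A" "y \<in> univ A"
  shows "join A x y \<in> P \<longleftrightarrow> x \<in> P \<or> y \<in> P"
  using assms unfolding prime_filter_def lattice_filter_def
  by (metis join_commute)

end


section \<open>Homomorphisms to the six-element algebra\<close>

text \<open>The unique value \<open>v\<close> for which \<open>p\<close>, \<open>q\<close> and \<open>c\<close> say whether \<open>v\<close>, \<open>six_neg v\<close> and
  \<open>six_circ v\<close> lie in the prime filter \<open>{V_b, V_t, V_th}\<close>. The test \<open>c\<close> singles out \<open>V_fh\<close> and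
  \<open>V_th\<close>, where \<open>q\<close> is the opposite of \<open>p\<close>; the other four values realize all combinations
  of \<open>p\<close> and \<open>q\<close>.\<close>

definition six_of_tests :: "bool \<Rightarrow> bool \<Rightarrow> bool \<Rightarrow> six" where
  "six_of_tests p q c =
     (if c then if p then V_th else V_fh
      else if p then if q then V_b else V_t
      else if q then V_f else V_n)"

context pp_algebra
begin

lemma neg_tp: "neg A (tp A) = bt A"
  by (metis join_bt meet_tp neg_closed neg_meet neg_neg tp_closed bt_closed join_bt_left
      meet_commute)

text \<open>On an element whose circle lies in \<open>P\<close> negation is classical. That \<open>P\<close> does not contain both
  \<open>x\<close> and its negation is PP4. For the other half, the negation of PP4 for \<open>x\<close> puts
  the join of \<open>x\<close>, \<open>neg A x\<close> and \<open>neg A (circ A x)\<close> into \<open>P\<close>; the last of these is not in \<open>P\<close>,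
  since PP1 turns PP4 for \<open>circ A x\<close> into \<open>meet A (circ A x) (neg A (circ A x)) = bt A\<close>.\<close>

lemma prime_filter_circ:
  assumes P: "prime_filter P" and x: "x \<in> univ A" and c: "circ A x \<in> P"
  shows "neg A x \<in> P \<longleftrightarrow> x \<notin> P"
proof
  have "bt A \<notin> P" using P by (simp add: prime_filter_def)
  then show "neg A x \<in> P \<Longrightarrow> x \<notin> P"
    using PP4[OF x] prime_filter_meet[OF P] x c by (metis circ_closed meet_closed neg_closed)
  have cn: "neg A (circ A x) \<notin> P"
    using PP4[of "circ A x"] PP1[OF x] prime_filter_meet[OF P] x c P \<open>bt A \<notin> P\<close>
    by (metis circ_closed meet_closed meet_tp neg_closed)
  have "neg A (meet A (meet A x (neg A x)) (circ A x)) = tp A"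
    using PP4[OF x] neg_tp by (metis neg_neg tp_closed)
  then have "join A (join A (neg A x) x) (neg A (circ A x)) \<in> P"
    using P x by (simp add: neg_meet neg_neg prime_filter_def meet_closed neg_closed circ_closed)
  then show "x \<notin> P \<Longrightarrow> neg A x \<in> P"
    using cn x by (simp add: prime_filter_join[OF P] join_closed neg_closed circ_closed)
qed

definition prime_filter_hom :: "'a set \<Rightarrow> 'a \<Rightarrow> six" where
  "prime_filter_hom P x = six_of_tests (x \<in> P) (neg A x \<in> P) (circ A x \<in> P)"

text \<open>The meet is the essential case. By PP5 the circle of a meet is in \<open>P\<close> iff both circles are, or one
  of them is and the negation of its argument is too. In \<open>PP6\<close> this says that \<open>inf u v\<close> is one of
  \<open>V_fh\<close> and \<open>V_th\<close> iff both arguments are, or one of them is \<open>V_fh\<close>. The join and the bottom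
  element reduce to the meet and the top element through negation.\<close>

lemma prime_filter_hom_in_hom:
  assumes P: "prime_filter P"
  shows "prime_filter_hom P \<in> hom A PP6"
proof -
  let ?h = "prime_filter_hom P"
  have mem: "tp A \<in> P" "bt A \<notin> P" using P by (auto simp: prime_filter_def)
  have hmeet: "?h (meet A x y) = inf (?h x) (?h y)" if "x \<in> univ A" "y \<in> univ A" for x y
  proof -
    note closed = meet_closed join_closed neg_closed circ_closed that
    have c: "circ A (meet A x y) \<in> P \<longleftrightarrow> (circ A x \<in> P \<or> circ A y \<in> P)
      \<and> (circ A x \<in> P \<or> neg A y \<in> P) \<and> (circ A y \<in> P \<or> neg A x \<in> P)"
      using that by (simp add: PP5 prime_filter_meet[OF P] prime_filter_join[OF P] closed)
    show ?thesis
      unfolding prime_filter_hom_def c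
      using prime_filter_circ[OF P, of x] prime_filter_circ[OF P, of y] that
      by (auto simp: prime_filter_meet[OF P] prime_filter_join[OF P] closed neg_meet
          six_of_tests_def inf_six_def less_eq_six_def)
  qed
  have hneg: "?h (neg A x) = six_neg (?h x)" if "x \<in> univ A" for x
    using prime_filter_circ[OF P that] PP2[OF that] that
    by (auto simp: prime_filter_hom_def six_of_tests_def neg_neg)
  have hcirc: "?h (circ A x) = six_circ (?h x)" if "x \<in> univ A" for x
    using that mem by (auto simp: prime_filter_hom_def six_of_tests_def PP1 six_circ_def)
  have htp: "?h (tp A) = top"
    using mem by (simp add: prime_filter_hom_def six_of_tests_def PP3 top_six_def)
  have hbt: "?h (bt A) = bot"
    using htp hneg[OF tp_closed] by (simp add: neg_tp top_six_def bot_six_def)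
  have six_sup: "sup u v = six_neg (inf (six_neg u) (six_neg v))" for u v
    by (cases u; cases v) (auto simp: inf_six_def sup_six_def less_eq_six_def)
  have hjoin: "?h (join A x y) = sup (?h x) (?h y)" if "x \<in> univ A" "y \<in> univ A" for x y
  proof -
    have "join A x y = neg A (meet A (neg A x) (neg A y))"
      using that by (simp add: neg_meet neg_neg neg_closed)
    then show ?thesis
      using that by (simp add: hneg hmeet meet_closed neg_closed six_sup)
  qed
  show ?thesis
    by (simp add: hom_def PP6_def hmeet hjoin hneg hcirc htp hbt)
qed

lemma homs_separate_points:
  assumes "a \<in> univ A" "b \<in> univ A" "a \<noteq> b"
  obtains h where "h \<in> hom A PP6" "h a \<noteq> h b"
proof -
  have "\<exists>h\<in>hom A PP6. h a \<noteq> h b" if ab: "a \<in> univ A" "b \<in> univ A" "meet A a b \<noteq> a" for a b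
  proof -
    obtain P where P: "prime_filter P" "a \<in> P" "b \<notin> P"
      using prime_filter_separation ab by blast
    have "prime_filter_hom P a \<noteq> prime_filter_hom P b"
      using P by (auto simp: prime_filter_hom_def six_of_tests_def)
    then show ?thesis using prime_filter_hom_in_hom P(1) by blast
  qed
  moreover have "meet A a b \<noteq> a \<or> meet A b a \<noteq> b"
    using assms meet_commute by metis
  ultimately show ?thesis
    using that assms by metis
qed

end


section \<open>Embedding into a power of the six-element algebra\<close>

lemma isomorphic_sym:
  assumes "isomorphic A B" and "pp_algebra A"
  shows "isomorphic B A"
proof -
  interpret pp_algebra A by fact
  obtain h where h: "h \<in> hom A B" and bij: "bij_betw h (univ A) (univ B)"
    using assms(1) by (auto simp: isomorphic_def)
  let ?g = "inv_into (univ A) h"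
  have img: "univ B = h ` univ A" using bij by (simp add: bij_betw_def)
  have g: "\<And>x. x \<in> univ A \<Longrightarrow> ?g (h x) = x"
    using bij by (simp add: bij_betw_def)
  note ops = hom_ops[OF h]
  have "?g \<in> hom B A"
    unfolding hom_def img
    by (auto simp: ops g meet_closed join_closed tp_closed bt_closed neg_closed circ_closed)
  moreover have "bij_betw ?g (univ B) (univ A)"
    using bij by (rule bij_betw_inv_into)
  ultimately show ?thesis by (auto simp: isomorphic_def)
qed

lemma hom_tupling:
  assumes "\<And>i. i \<in> I \<Longrightarrow> k i \<in> hom A (F i)"
  shows "(\<lambda>x. \<lambda>i\<in>I. k i x) \<in> hom A (direct_product I F)"
proof -
  have "k i x \<in> univ (F i)" if "i \<in> I" "x \<in> univ A" for i x
    using assms[OF that(1)] that(2) by (auto simp: hom_def)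
  moreover note ops = hom_ops[OF assms]
  ultimately show ?thesis
    unfolding hom_def direct_product_def
    by (auto intro!: restrict_ext simp: ops)
qed

lemma hom_range_subuniverse:
  assumes "pp_algebra A" and h: "h \<in> hom A B"
  shows "subuniverse (h ` univ A) B"
proof -
  interpret pp_algebra A by fact
  show ?thesis
    using h unfolding subuniverse_def
    by (auto simp: hom_ops[OF h] meet_closed join_closed tp_closed bt_closed neg_closed circ_closed)
      (auto simp: hom_def)
qed

lemma hom_restrict_codomain: "h \<in> hom A B \<Longrightarrow> h \<in> hom A (B\<lparr>univ := h ` univ A\<rparr>)"
  by (simp add: hom_def)

text \<open>The factors and the index set of a product have to live in the type \<open>'i \<Rightarrow> six\<close> of the elements of
  the power. So \<open>PP6\<close> is replaced by its copy \<open>C\<close> on the constant functions, and each index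
  \<open>i\<close> is replaced by the characteristic function of \<open>{i}\<close>.\<close>

lemma power_in_variety_in:
  fixes H :: "'i set"
  shows "direct_product H (\<lambda>_. PP6) \<in> (variety_in {PP6} :: ('i \<Rightarrow> six) pp_alg set)"
proof -
  define C :: "('i \<Rightarrow> six) pp_alg" where
    "C = \<lparr> univ = range (\<lambda>v _. v), meet = (\<lambda>f g i. inf (f i) (g i)),
      join = (\<lambda>f g i. sup (f i) (g i)), tp = (\<lambda>_. top), bt = (\<lambda>_. bot),
      neg = (\<lambda>f i. six_neg (f i)), circ = (\<lambda>f i. six_circ (f i)) \<rparr>"
  have "isomorphic PP6 C"
    unfolding isomorphic_def
  proof
    show "(\<lambda>v _. v) \<in> hom PP6 C"
      by (auto simp: hom_def PP6_def C_def)
    show "bij_betw (\<lambda>v _. v) (univ PP6) (univ C)"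
      by (auto simp: bij_betw_def inj_on_def PP6_def C_def fun_eq_iff)
  qed
  then have C: "C \<in> variety_in {PP6}"
    by (blast intro: variety_in.generator)
  define e :: "'i \<Rightarrow> 'i \<Rightarrow> six" where "e i = (\<lambda>j. if j = i then V_th else V_fh)" for i
  have e: "e i = e j \<longleftrightarrow> i = j" for i j
    by (auto simp: e_def fun_eq_iff)
  let ?D = "direct_product (e ` H) (\<lambda>_. C)"
  \<comment> \<open>The component \<open>f (e i)\<close> is a constant function, so its value may be read off at any
    argument, for instance at \<open>i\<close>.\<close>
  let ?r = "\<lambda>f. \<lambda>i\<in>H. f (e i) i"
  have "isomorphic ?D (direct_product H (\<lambda>_. PP6))"
    unfolding isomorphic_def
  proof
    show "?r \<in> hom ?D (direct_product H (\<lambda>_. PP6))"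
      by (rule hom_tupling) (auto simp: hom_def direct_product_def PP6_def C_def)
    show "bij_betw ?r (univ ?D) (univ (direct_product H (\<lambda>_. PP6)))"
    proof (rule bij_betw_byWitness[where f' = "\<lambda>g. \<lambda>k\<in>e ` H. \<lambda>_. g (inv e k)"])
      have inv: "inv e (e i) = i" for i
        using e by (simp add: inj_def)
      show "\<forall>f\<in>univ ?D. (\<lambda>k\<in>e ` H. \<lambda>_. ?r f (inv e k)) = f"
      proof
        fix f assume f: "f \<in> univ ?D"
        show "(\<lambda>k\<in>e ` H. \<lambda>_. ?r f (inv e k)) = f"
        proof
          fix k
          show "(\<lambda>k\<in>e ` H. \<lambda>_. ?r f (inv e k)) k = f k"
          proof (cases "k \<in> e ` H")
            case True
            then obtain i where i: "i \<in> H" "k = e i" by blast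
            then obtain v where "f k = (\<lambda>_. v)"
              using f by (auto simp: direct_product_def C_def)
            then show ?thesis using i inv by auto
          next
            case False
            then show ?thesis using f by (auto simp: direct_product_def PiE_def extensional_def)
          qed
        qed
      qed
      show "\<forall>g\<in>univ (direct_product H (\<lambda>_. PP6)). ?r (\<lambda>k\<in>e ` H. \<lambda>_. g (inv e k)) = g"
        by (auto simp: direct_product_def PP6_def inv PiE_def extensional_def fun_eq_iff)
      show "?r ` univ ?D \<subseteq> univ (direct_product H (\<lambda>_. PP6))"
        by (auto simp: direct_product_def PP6_def)
      show "(\<lambda>g. \<lambda>k\<in>e ` H. \<lambda>_. g (inv e k)) ` univ (direct_product H (\<lambda>_. PP6)) \<subseteq> univ ?D"
        by (auto simp: direct_product_def C_def)
    qed
  qed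
  with C show ?thesis
    by (rule variety_in.product)
qed

text \<open>The embedding sends \<open>x\<close> to the evaluation \<open>h \<mapsto> h x\<close> of homomorphisms at \<open>x\<close>; it is injective
  because homomorphisms to \<open>PP6\<close> separate points. If \<open>A\<close> has one element, \<open>hom A PP6\<close> is empty
  and the power has one element as well.\<close>

lemma isomorphic_subalgebra_of_power:
  assumes "pp_algebra A"
  obtains S where "subuniverse S (direct_product (hom A PP6) (\<lambda>_. PP6))"
    and "isomorphic A ((direct_product (hom A PP6) (\<lambda>_. PP6))\<lparr>univ := S\<rparr>)"
proof
  let ?B = "direct_product (hom A PP6) (\<lambda>_. PP6)"
  let ?d = "\<lambda>x. \<lambda>h\<in>hom A PP6. h x"
  have d: "?d \<in> hom A ?B"
    by (rule hom_tupling)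
  show "subuniverse (?d ` univ A) ?B"
    using assms d by (rule hom_range_subuniverse)
  have inj: "inj_on ?d (univ A)"
  proof (rule inj_onI, rule ccontr)
    fix a b assume ab: "a \<in> univ A" "b \<in> univ A" "?d a = ?d b" "a \<noteq> b"
    then obtain h where "h \<in> hom A PP6" "h a \<noteq> h b"
      using pp_algebra.homs_separate_points[OF assms] by blast
    then show False
      using fun_cong[OF ab(3), of h] by simp
  qed
  show "isomorphic A (?B\<lparr>univ := ?d ` univ A\<rparr>)"
    unfolding isomorphic_def
  proof
    show "?d \<in> hom A (?B\<lparr>univ := ?d ` univ A\<rparr>)"
      using d by (rule hom_restrict_codomain)
    show "bij_betw ?d (univ A) (univ (?B\<lparr>univ := ?d ` univ A\<rparr>))"
      using inj by (simp add: bij_betw_def)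
  qed
qed

theorem proposition3p8:
  fixes A :: "'a pp_alg"
  shows "(in_variety TYPE('u) {PP6} A \<longrightarrow> pp_algebra A) \<and>
         (pp_algebra A \<longrightarrow> in_variety TYPE(('a \<Rightarrow> six) \<Rightarrow> six) {PP6} A)"
proof (intro conjI impI)
  assume "in_variety TYPE('u) {PP6} A"
  then obtain B where "B \<in> (variety_in {PP6} :: 'u pp_alg set)" "isomorphic B A"
    unfolding in_variety_def by blast
  then show "pp_algebra A"
    using pp_algebra_variety_in pp_algebra_PP6 pp_algebra_hom_image isomorphic_imp_hom_image
    by (metis singletonD)
next
  assume A: "pp_algebra A"
  then obtain S where S: "subuniverse S (direct_product (hom A PP6) (\<lambda>_. PP6))"
    and iso: "isomorphic A ((direct_product (hom A PP6) (\<lambda>_. PP6))\<lparr>univ := S\<rparr>)"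
    by (rule isomorphic_subalgebra_of_power)
  from S have "(direct_product (hom A PP6) (\<lambda>_. PP6))\<lparr>univ := S\<rparr> \<in> variety_in {PP6}"
    by (rule variety_in.subalgebra[OF power_in_variety_in])
  with isomorphic_sym[OF iso A] show "in_variety TYPE(('a \<Rightarrow> six) \<Rightarrow> six) {PP6} A"
    unfolding in_variety_def by blast
qed

end
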